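(* Let $E$ be an analytic equivalence relation on a Polish space $Y$. Then either (i) $E_0^{\mathbb{N}}$ is Borel reducible to $E$, or (ii) for every Borel homomorphism $f\colon (2^{\mathbb{N}})^{\mathbb{N}}\to Y$ from $E_0^{\mathbb{N}}$ to $E$ there is $k\in\mathbb{N}$ and a Borel homomorphism $h$ from $E_0^k$ to $E$, defined on a comeager subset of $(2^{\mathbb{N}})^k$, such that for comeager many $x\in(2^{\mathbb{N}})^{\mathbb{N}}$ we have $h(\pi_k(x))\mathrel{E} f(x)$.
   Context: $E_0$ is the equivalence relation on $2^{\mathbb{N}}$ of eventual equality of binary sequences. For a set $X$, $E_0^X$ is the product equivalence relation on $(2^{\mathbb{N}})^X$: $x \mathrel{E_0^X} y$ iff $x(i)\mathrel{E_0} y(i)$ for all $i\in X$; for $k\in\mathbb{N}$, $E_0^k$ is this with $X=k=\{0,\dots,k-1\}$. The map $\pi_k\colon(2^{\mathbb{N}})^{\mathbb{N}}\to(2^{\mathbb{N}})^k$ is the projection $x\mapsto x\restriction k$. For equivalence relations $E,F$ on Polish spaces $X,Y$, a map $f\colon X\to Y$ is a homomorphism from $E$ to $F$ if $x_1\mathrel{E}x_2\Rightarrow f(x_1)\mathrel{F}f(x_2)$, and a reduction if $x_1\mathrel{E}x_2\iff f(x_1)\mathrel{F}f(x_2)$; $E\le_B F$ (Borel reducible) means there is a Borel reduction from $E$ to $F$. All spaces carry the product topology. *)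

theory Defs
  imports "HOL-Analysis.Analysis"
begin

text \<open>Spaces are abstract topologies rather than types of a topological type class: the
  exponent \<open>k\<close> of the spaces \<open>(2\<^sup>\<nat>)\<^sup>k\<close> varies inside the statement, partial maps live on
  subspaces, and a Polish space may be empty.\<close>

definition Polish_space :: "'a topology \<Rightarrow> bool" where
  "Polish_space X \<longleftrightarrow> completely_metrizable_space X \<and> separable_space X"

definition borel_of :: "'a topology \<Rightarrow> 'a measure" where
  "borel_of X = sigma (topspace X) {U. openin X U}"

text \<open>As usual for functions between carriers, the values of \<open>f\<close> outside \<open>topspace X\<close> are
  irrelevant. Partial Borel maps are obtained by taking \<open>X\<close> to be a subspace.\<close>

definition Borel_map :: "'a topology \<Rightarrow> 'b topology \<Rightarrow> ('a \<Rightarrow> 'b) \<Rightarrow> bool" where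
  "Borel_map X Y f \<longleftrightarrow> f \<in> borel_of X \<rightarrow>\<^sub>M borel_of Y"

definition nowhere_dense_in :: "'a topology \<Rightarrow> 'a set \<Rightarrow> bool" where
  "nowhere_dense_in X S \<longleftrightarrow> S \<subseteq> topspace X \<and> X interior_of (X closure_of S) = {}"

definition meager_in :: "'a topology \<Rightarrow> 'a set \<Rightarrow> bool" where
  "meager_in X S \<longleftrightarrow> (\<exists>\<N>. countable \<N> \<and> (\<forall>N\<in>\<N>. nowhere_dense_in X N) \<and> S = \<Union>\<N>)"

definition comeager_in :: "'a topology \<Rightarrow> 'a set \<Rightarrow> bool" where
  "comeager_in X S \<longleftrightarrow> S \<subseteq> topspace X \<and> meager_in X (topspace X - S)"

definition Baire_space :: "(nat \<Rightarrow> nat) topology" where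
  "Baire_space = product_topology (\<lambda>_. discrete_topology UNIV) UNIV"

text \<open>Analytic subsets of a Polish space \<open>X\<close>: continuous images of the Baire space, together
  with the empty set.\<close>

definition analytic_in :: "'a topology \<Rightarrow> 'a set \<Rightarrow> bool" where
  "analytic_in X A \<longleftrightarrow>
     A = {} \<or> (\<exists>g. continuous_map Baire_space X g \<and> g ` topspace Baire_space = A)"

definition Cantor_space :: "(nat \<Rightarrow> bool) topology" where
  "Cantor_space = product_topology (\<lambda>_. discrete_topology UNIV) UNIV"

text \<open>Points of \<open>(2\<^sup>\<nat>)\<^sup>I\<close> are the functions that are \<open>undefined\<close> outside \<open>I\<close>.\<close>

definition Cantor_power :: "'i set \<Rightarrow> ('i \<Rightarrow> nat \<Rightarrow> bool) topology" where
  "Cantor_power I = product_topology (\<lambda>_. Cantor_space) I"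

definition E0 :: "(nat \<Rightarrow> bool) rel" where
  "E0 = {(a, b). \<exists>m. \<forall>n\<ge>m. a n = b n}"

definition E0_power :: "'i set \<Rightarrow> ('i \<Rightarrow> nat \<Rightarrow> bool) rel" where
  "E0_power I = {(x, y). x \<in> topspace (Cantor_power I) \<and> y \<in> topspace (Cantor_power I) \<and>
                         (\<forall>i\<in>I. (x i, y i) \<in> E0)}"

definition proj :: "nat \<Rightarrow> (nat \<Rightarrow> nat \<Rightarrow> bool) \<Rightarrow> (nat \<Rightarrow> nat \<Rightarrow> bool)" where
  "proj k x = restrict x {..<k}"

definition Borel_homomorphism ::
    "'a topology \<Rightarrow> 'a rel \<Rightarrow> 'b topology \<Rightarrow> 'b rel \<Rightarrow> ('a \<Rightarrow> 'b) \<Rightarrow> bool" where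
  "Borel_homomorphism X E Y F f \<longleftrightarrow> Borel_map X Y f \<and>
     (\<forall>x1\<in>topspace X. \<forall>x2\<in>topspace X. (x1, x2) \<in> E \<longrightarrow> (f x1, f x2) \<in> F)"

definition Borel_reduction ::
    "'a topology \<Rightarrow> 'a rel \<Rightarrow> 'b topology \<Rightarrow> 'b rel \<Rightarrow> ('a \<Rightarrow> 'b) \<Rightarrow> bool" where
  "Borel_reduction X E Y F f \<longleftrightarrow> Borel_map X Y f \<and>
     (\<forall>x1\<in>topspace X. \<forall>x2\<in>topspace X. (x1, x2) \<in> E \<longleftrightarrow> (f x1, f x2) \<in> F)"

definition Borel_reducible ::
    "'a topology \<Rightarrow> 'a rel \<Rightarrow> 'b topology \<Rightarrow> 'b rel \<Rightarrow> bool" where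
  "Borel_reducible X E Y F \<longleftrightarrow> (\<exists>f. Borel_reduction X E Y F f)"

end

theory Submission
  imports Defs
begin

text \<open>
  Let \<open>X = (2\<^sup>\<nat>)\<^sup>\<nat>\<close>, let \<open>f\<close> be a homomorphism from \<open>E\<^sub>0\<^sup>\<nat>\<close> to \<open>E\<close>, and let \<open>S k\<close> be the set of
  pairs \<open>(x, y)\<close> in \<open>X \<times> X\<close> such that \<open>f\<close> sends \<open>x\<close> and the point that agrees with \<open>x\<close> on the first
  \<open>k\<close> coordinates and with \<open>y\<close> on the others to equivalent points. The set \<open>S k\<close> is analytic and
  invariant under finite changes of both coordinates, so it is meager or comeager.

  If some \<open>S k\<close> is comeager, then by Kuratowski--Ulam there is a \<open>y\<close> with \<open>(x, y) \<in> S k\<close> for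
  comeager many \<open>x\<close>, and \<open>h z = f (z followed by y)\<close> is a homomorphism on all of \<open>(2\<^sup>\<nat>)\<^sup>k\<close>.
  If every \<open>S k\<close> is meager, a fusion argument yields a continuous homomorphism \<open>g\<close> from
  \<open>E\<^sub>0\<^sup>\<nat>\<close> to itself such that \<open>(g x, g y) \<notin> S k\<close> or \<open>(g y, g x) \<notin> S k\<close> whenever \<open>k\<close> is the least
  coordinate at which \<open>x\<close> and \<open>y\<close> are \<open>E\<^sub>0\<close>-inequivalent; then \<open>f \<circ> g\<close> is a reduction.
\<close>

section \<open>Meager sets\<close>

lemma nowhere_dense_in_subset:
  "nowhere_dense_in T S" if "nowhere_dense_in T S'" "S \<subseteq> S'"
proof -
  have "T interior_of (T closure_of S) \<subseteq> T interior_of (T closure_of S')"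
    using that by (intro interior_of_mono closure_of_mono)
  then show ?thesis
    using that by (auto simp: nowhere_dense_in_def)
qed

lemma meager_in_nowhere_dense: "nowhere_dense_in T S \<Longrightarrow> meager_in T S"
  unfolding meager_in_def by (intro exI[of _ "{S}"]) auto

lemma meager_in_empty: "meager_in T {}"
  unfolding meager_in_def by (intro exI[of _ "{}"]) auto

lemma meager_in_subset:
  assumes "meager_in T S'" "S \<subseteq> S'"
  shows "meager_in T S"
proof -
  obtain \<N> where \<N>: "countable \<N>" "\<forall>N\<in>\<N>. nowhere_dense_in T N" "S' = \<Union>\<N>"
    using assms(1) by (auto simp: meager_in_def)
  have "countable ((\<lambda>N. N \<inter> S) ` \<N>)" "S = \<Union>((\<lambda>N. N \<inter> S) ` \<N>)"
    using \<N> assms(2) by auto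
  moreover have "\<forall>N\<in>(\<lambda>N. N \<inter> S) ` \<N>. nowhere_dense_in T N"
    using \<N>(2) by (auto intro: nowhere_dense_in_subset)
  ultimately show ?thesis
    unfolding meager_in_def by blast
qed

lemma meager_in_UN:
  assumes "countable I" "\<And>i. i \<in> I \<Longrightarrow> meager_in T (S i)"
  shows "meager_in T (\<Union>i\<in>I. S i)"
proof -
  obtain \<N> where \<N>: "\<And>i. i \<in> I \<Longrightarrow>
      countable (\<N> i) \<and> (\<forall>N\<in>\<N> i. nowhere_dense_in T N) \<and> S i = \<Union>(\<N> i)"
    using assms(2) unfolding meager_in_def by metis
  have "countable (\<Union>i\<in>I. \<N> i)"
    using assms(1) \<N> by (intro countable_UN) auto
  moreover have "\<forall>N\<in>(\<Union>i\<in>I. \<N> i). nowhere_dense_in T N"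
    using \<N> by auto
  moreover have "(\<Union>i\<in>I. S i) = \<Union>(\<Union>i\<in>I. \<N> i)"
    using \<N> by auto
  ultimately show ?thesis
    unfolding meager_in_def by (intro exI conjI)
qed

lemma meager_in_Union:
  "countable \<S> \<Longrightarrow> (\<And>S. S \<in> \<S> \<Longrightarrow> meager_in T S) \<Longrightarrow> meager_in T (\<Union>\<S>)"
  using meager_in_UN[of \<S> T "\<lambda>S. S"] by simp

lemma meager_in_Un: "meager_in T S \<Longrightarrow> meager_in T S' \<Longrightarrow> meager_in T (S \<union> S')"
  using meager_in_Union[of "{S, S'}" T] by auto

lemma nowhere_dense_in_closed_diff_interior:
  assumes "closedin T H"
  shows "nowhere_dense_in T (H - T interior_of H)"
proof -
  have "closedin T (H - T interior_of H)"
    using assms by (simp add: closedin_diff)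
  moreover have "T interior_of (H - T interior_of H) = {}"
  proof -
    have "T interior_of (H - T interior_of H) \<subseteq> T interior_of H"
      by (intro interior_of_mono) auto
    moreover have "T interior_of (H - T interior_of H) \<subseteq> H - T interior_of H"
      by (rule interior_of_subset)
    ultimately show ?thesis by blast
  qed
  ultimately show ?thesis
    using closedin_subset by (auto simp: nowhere_dense_in_def closure_of_closedin)
qed

lemma nowhere_dense_in_closure_diff_open:
  assumes "openin T G"
  shows "nowhere_dense_in T (T closure_of G - G)"
proof -
  have "closedin T (T closure_of G - G)"
    using assms by (simp add: closedin_diff)
  moreover have "T interior_of (T closure_of G - G) = {}"
  proof -
    let ?V = "T interior_of (T closure_of G - G)"
    have "?V \<subseteq> T closure_of G - G" "openin T ?V"
      by (auto simp: interior_of_subset)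
    moreover have "?V \<inter> G = {}" using calculation by blast
    ultimately have "?V \<inter> T closure_of G = {}"
      by (simp add: openin_Int_closure_of_eq_empty)
    then show ?thesis using \<open>?V \<subseteq> _\<close> by blast
  qed
  ultimately show ?thesis
    using closedin_subset by (auto simp: nowhere_dense_in_def closure_of_closedin)
qed

lemma homeomorphic_map_meager_in:
  assumes hom: "homeomorphic_map T T' \<tau>" and "meager_in T S"
  shows "meager_in T' (\<tau> ` S)"
proof -
  obtain \<N> where \<N>: "countable \<N>" "\<forall>N\<in>\<N>. nowhere_dense_in T N" "S = \<Union>\<N>"
    using assms(2) by (auto simp: meager_in_def)
  have "nowhere_dense_in T' (\<tau> ` N)" if "N \<in> \<N>" for N
  proof -
    have N: "N \<subseteq> topspace T" "T interior_of (T closure_of N) = {}"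
      using \<N>(2) that by (auto simp: nowhere_dense_in_def)
    have "T' interior_of (T' closure_of (\<tau> ` N)) = \<tau> ` (T interior_of (T closure_of N))"
      using homeomorphic_map_closure_of[OF hom N(1)]
        homeomorphic_map_interior_of[OF hom closure_of_subset_topspace] by metis
    moreover have "\<tau> ` N \<subseteq> topspace T'"
      using hom N(1) homeomorphic_imp_surjective_map by fastforce
    ultimately show ?thesis
      using N(2) by (simp add: nowhere_dense_in_def)
  qed
  moreover have "\<tau> ` S = \<Union>((`) \<tau> ` \<N>)"
    using \<N>(3) by blast
  ultimately show ?thesis
    unfolding meager_in_def using \<N>(1) by (metis (no_types, lifting) countable_image imageE)
qed

section \<open>Comeager sets and countable intersections of dense open sets\<close>

lemma dense_open_Int:
  assumes "openin T U" "T closure_of U = topspace T" "openin T V" "T closure_of V = topspace T"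
  shows "T closure_of (U \<inter> V) = topspace T"
proof -
  have "T closure_of (U \<inter> V) = T closure_of (U \<inter> T closure_of V)"
    using assms(1) by (rule closure_of_openin_Int_closure_of[symmetric])
  also have "U \<inter> T closure_of V = U"
    using assms(1,4) openin_subset by auto
  finally show ?thesis using assms(2) by simp
qed

lemma dense_open_INT:
  assumes "finite I" "I \<noteq> {}"
    and "\<And>i. i \<in> I \<Longrightarrow> openin T (U i) \<and> T closure_of (U i) = topspace T"
  shows "openin T (\<Inter>i\<in>I. U i) \<and> T closure_of (\<Inter>i\<in>I. U i) = topspace T"
  using assms by (induction rule: finite_ne_induct) (auto simp: dense_open_Int openin_Int)

text \<open>Complements of the closures of the nowhere dense pieces are dense and open. Finite
  intersections of them make the sequence decreasing, so that a point lying in infinitely many of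
  the sets lies in all of them; the fusion argument relies on this.\<close>

lemma comeager_in_open_dense_sequence:
  assumes "comeager_in T S"
  obtains U :: "nat \<Rightarrow> 'a set"
    where "\<And>n. openin T (U n)" "\<And>n. T closure_of (U n) = topspace T"
      "(\<Inter>n. U n) \<subseteq> S" "decseq U"
proof -
  obtain \<N> where \<N>: "countable \<N>" "\<forall>N\<in>\<N>. nowhere_dense_in T N" "topspace T - S = \<Union>\<N>"
    using assms by (auto simp: meager_in_def comeager_in_def)
  have nd0: "nowhere_dense_in T {}"
    by (simp add: nowhere_dense_in_def)
  \<comment> \<open>The empty set is inserted so that \<open>from_nat_into\<close> enumerates a
    nonempty family even when \<open>\<N>\<close> is empty.\<close>
  define N where "N = from_nat_into (insert {} \<N>)"
  have range_N: "range N = insert {} \<N>"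
    using \<N>(1) by (simp add: N_def)
  have ndN: "nowhere_dense_in T (N n)" for n
    using range_N \<N>(2) nd0 by (metis insertE rangeI)
  define V where "V n = topspace T - T closure_of (N n)" for n
  have V: "openin T (V n)" "T closure_of (V n) = topspace T" for n
    using ndN[of n] by (auto simp: V_def closure_of_complement nowhere_dense_in_def)
  define U where "U n = (\<Inter>i\<in>{..n}. V i)" for n
  have U: "openin T (U n) \<and> T closure_of (U n) = topspace T" for n
    unfolding U_def by (rule dense_open_INT) (auto simp: V)
  have "(\<Inter>n. U n) \<subseteq> S"
  proof
    fix x assume x: "x \<in> (\<Inter>n. U n)"
    then have xV: "x \<in> V n" for n
      by (auto simp: U_def)
    have "x \<notin> N n" for n
      using xV[of n] ndN[of n] closure_of_subset[of "N n" T]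
      by (auto simp: V_def nowhere_dense_in_def)
    then have "x \<notin> \<Union>\<N>"
      using range_N by (metis Union_iff insertCI rangeE)
    moreover have "x \<in> topspace T"
      using xV[of 0] by (simp add: V_def)
    ultimately show "x \<in> S" using \<N>(3) by blast
  qed
  moreover have "decseq U"
    unfolding U_def decseq_def by (auto intro: INF_superset_mono)
  ultimately show thesis
    using that U by blast
qed

lemma comeager_in_INT_open_dense:
  fixes U :: "'i \<Rightarrow> 'a set"
  assumes "countable I" "\<And>i. i \<in> I \<Longrightarrow> openin T (U i)"
    "\<And>i. i \<in> I \<Longrightarrow> T closure_of (U i) = topspace T" "(\<Inter>i\<in>I. U i) \<subseteq> S" "S \<subseteq> topspace T"
  shows "comeager_in T S"
proof -
  have "nowhere_dense_in T (topspace T - U i)" if "i \<in> I" for i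
    using assms(2,3)[OF that]
    by (simp add: nowhere_dense_in_def interior_of_complement closure_of_complement interior_of_openin)
  then have "meager_in T (\<Union>i\<in>I. topspace T - U i)"
    by (intro meager_in_UN assms(1)) (auto intro: meager_in_nowhere_dense)
  then have "meager_in T (topspace T - S)"
    by (rule meager_in_subset) (use assms in auto)
  then show ?thesis using assms(5) by (simp add: comeager_in_def)
qed

section \<open>The Baire property of Borel and analytic sets\<close>

lemma space_borel_of: "space (borel_of T) = topspace T"
  by (simp add: borel_of_def space_measure_of_conv)

lemma sets_borel_of: "sets (borel_of T) = sigma_sets (topspace T) {U. openin T U}"
proof -
  have "{U. openin T U} \<subseteq> Pow (topspace T)"
    using openin_subset by auto
  then show ?thesis by (simp add: borel_of_def)
qed

lemma openin_imp_sets_borel_of: "openin T U \<Longrightarrow> U \<in> sets (borel_of T)"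
  by (auto simp: sets_borel_of)

text \<open>The sets that are open modulo a meager set form a sigma-algebra. For a complement the
  approximating open set is the exterior of \<open>U\<close>, and the boundary of \<open>U\<close>
  is the additional meager error.\<close>

lemma Borel_imp_open_mod_meager:
  assumes "S \<in> sets (borel_of T)"
  shows "\<exists>U. openin T U \<and> meager_in T ((S - U) \<union> (U - S))"
proof -
  have "S \<in> sigma_sets (topspace T) {U. openin T U}"
    using assms by (simp add: sets_borel_of)
  then show ?thesis
  proof induction
    case (Basic U)
    then show ?case by (intro exI[of _ U]) (auto simp: meager_in_empty)
  next
    case Empty
    then show ?case by (intro exI[of _ "{}"]) (auto simp: meager_in_empty)
  next
    case (Compl S)
    then obtain U where U: "openin T U" "meager_in T ((S - U) \<union> (U - S))" by blast
    have "meager_in T ((S - U) \<union> (U - S) \<union> (T closure_of U - U))"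
      using meager_in_Un[OF U(2) meager_in_nowhere_dense[OF nowhere_dense_in_closure_diff_open[OF U(1)]]] .
    then have "meager_in T ((topspace T - S - (topspace T - T closure_of U)) \<union>
        ((topspace T - T closure_of U) - (topspace T - S)))"
      by (rule meager_in_subset) (use closure_of_subset[OF openin_subset[OF U(1)]] in blast)
    then show ?case
      by (intro exI[of _ "topspace T - T closure_of U"]) (simp add: openin_diff)
  next
    case (Union S)
    then obtain U where U: "\<And>n::nat. openin T (U n)" "\<And>n. meager_in T ((S n - U n) \<union> (U n - S n))"
      by metis
    have "meager_in T (\<Union>n. (S n - U n) \<union> (U n - S n))"
      using U(2) by (intro meager_in_UN) auto
    then have "meager_in T ((\<Union>n. S n) - (\<Union>n. U n) \<union> ((\<Union>n. U n) - (\<Union>n. S n)))"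
      by (rule meager_in_subset) blast
    then show ?case using U(1) by (intro exI[of _ "\<Union>n. U n"]) auto
  qed
qed

text \<open>For every basic open \<open>V\<close>, delete the meager difference between the preimage
  of \<open>V\<close> and an open set approximating it. On the remaining comeager set the preimages
  of basic open sets are relatively open.\<close>

lemma Borel_map_continuous_on_comeager:
  assumes f: "Borel_map T Y f" and Y: "second_countable Y"
  obtains C where "comeager_in T C" "continuous_map (subtopology T C) Y f"
proof -
  obtain \<B> where \<B>: "countable \<B>" "\<And>V. V \<in> \<B> \<Longrightarrow> openin Y V"
    "\<And>U y. openin Y U \<Longrightarrow> y \<in> U \<Longrightarrow> \<exists>V\<in>\<B>. y \<in> V \<and> V \<subseteq> U"
    using Y unfolding second_countable_def by metis
  let ?P = "\<lambda>V. f -` V \<inter> topspace T"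
  have "?P V \<in> sets (borel_of T)" if "V \<in> \<B>" for V
    using measurable_sets[OF f[unfolded Borel_map_def] openin_imp_sets_borel_of[OF \<B>(2)[OF that]]]
    by (simp add: space_borel_of)
  then obtain U where U: "\<And>V. V \<in> \<B> \<Longrightarrow> openin T (U V)"
    "\<And>V. V \<in> \<B> \<Longrightarrow> meager_in T ((?P V - U V) \<union> (U V - ?P V))"
    using Borel_imp_open_mod_meager[of "?P _" T] by metis
  define M where "M = (\<Union>V\<in>\<B>. (?P V - U V) \<union> (U V - ?P V))"
  have "meager_in T M"
    unfolding M_def using \<B>(1) U(2) by (intro meager_in_UN) auto
  then have "comeager_in T (topspace T - M)"
    by (auto simp: comeager_in_def intro: meager_in_subset)
  moreover have "continuous_map (subtopology T (topspace T - M)) Y f"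
    unfolding continuous_map
  proof (intro conjI allI impI)
    show "f ` topspace (subtopology T (topspace T - M)) \<subseteq> topspace Y"
      using f by (auto simp: Borel_map_def measurable_def space_borel_of)
    fix W assume W: "openin Y W"
    let ?S = "{x \<in> topspace (subtopology T (topspace T - M)). f x \<in> W}"
    have "?S = (\<Union>V\<in>{V\<in>\<B>. V \<subseteq> W}. U V) \<inter> (topspace T - M)"
    proof (intro equalityI subsetI)
      fix x assume x: "x \<in> ?S"
      then obtain V where V: "V \<in> \<B>" "f x \<in> V" "V \<subseteq> W"
        using \<B>(3)[OF W, of "f x"] by auto
      then have "x \<in> U V"
        using x by (auto simp: M_def)
      then show "x \<in> (\<Union>V\<in>{V\<in>\<B>. V \<subseteq> W}. U V) \<inter> (topspace T - M)"
        using x V by auto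
    next
      fix x assume x: "x \<in> (\<Union>V\<in>{V\<in>\<B>. V \<subseteq> W}. U V) \<inter> (topspace T - M)"
      then obtain V where V: "V \<in> \<B>" "V \<subseteq> W" "x \<in> U V"
        by blast
      then have "x \<in> ?P V"
        using x by (auto simp: M_def)
      then show "x \<in> ?S" using x V by auto
    qed
    moreover have "openin T (\<Union>V\<in>{V\<in>\<B>. V \<subseteq> W}. U V)"
      using U(1) by auto
    ultimately show "openin (subtopology T (topspace T - M)) ?S"
      by (auto simp: openin_subtopology)
  qed
  ultimately show thesis using that by blast
qed

section \<open>Local category and analytic sets\<close>

text \<open>The points at which \<open>S\<close> is locally nonmeager: each of their open
  neighbourhoods meets \<open>S\<close> in a nonmeager set. This is a closed envelope of
  \<open>S\<close> up to a meager set when the space is second countable.\<close>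

definition meager_hull :: "'a topology \<Rightarrow> 'a set \<Rightarrow> 'a set" where
  "meager_hull T S = topspace T - \<Union>{U. openin T U \<and> meager_in T (U \<inter> S)}"

lemma closedin_meager_hull: "closedin T (meager_hull T S)"
  unfolding meager_hull_def by (intro closedin_diff) auto

lemma meager_in_diff_meager_hull:
  assumes T: "second_countable T" and "S \<subseteq> topspace T"
  shows "meager_in T (S - meager_hull T S)"
proof -
  obtain \<B> where \<B>: "countable \<B>" "\<And>V. V \<in> \<B> \<Longrightarrow> openin T V"
    "\<And>U y. openin T U \<Longrightarrow> y \<in> U \<Longrightarrow> \<exists>V\<in>\<B>. y \<in> V \<and> V \<subseteq> U"
    using T unfolding second_countable_def by metis
  let ?\<B> = "{V\<in>\<B>. meager_in T (V \<inter> S)}"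
  have "meager_in T (\<Union>V\<in>?\<B>. V \<inter> S)"
    using \<B>(1) by (intro meager_in_UN) auto
  moreover have "S - meager_hull T S \<subseteq> (\<Union>V\<in>?\<B>. V \<inter> S)"
  proof
    fix x assume x: "x \<in> S - meager_hull T S"
    then obtain U where U: "openin T U" "meager_in T (U \<inter> S)" "x \<in> U"
      using assms(2) by (auto simp: meager_hull_def)
    then obtain V where V: "V \<in> \<B>" "x \<in> V" "V \<subseteq> U"
      using \<B>(3) by blast
    then have "meager_in T (V \<inter> S)"
      using U(2) by (auto intro: meager_in_subset)
    then show "x \<in> (\<Union>V\<in>?\<B>. V \<inter> S)"
      using V x by auto
  qed
  ultimately show ?thesis by (rule meager_in_subset)
qed

text \<open>Away from the closure of the interiors of the sets \<open>meager_hull T (S' n)\<close>,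
  each \<open>S' n\<close> is meager, hence so is \<open>S\<close>; an open set there contains no
  point of the hull of \<open>S\<close>. What remains is covered by boundaries.\<close>

lemma meager_in_hull_diff_UN_hull:
  assumes T: "second_countable T" and S: "S = (\<Union>n::nat. S' n)" "S \<subseteq> topspace T"
  shows "meager_in T (meager_hull T S - (\<Union>n. meager_hull T (S' n)))"
proof -
  let ?H = "meager_hull T S" and ?H' = "\<lambda>n. meager_hull T (S' n)"
  define G where "G = (\<Union>n. T interior_of ?H' n)"
  have G: "openin T G" by (auto simp: G_def)
  define V where "V = T interior_of ?H - T closure_of G"
  have V: "openin T V" by (auto simp: V_def openin_diff)
  have "meager_in T (V \<inter> S)"
  proof -
    have "meager_in T (\<Union>n. (S' n - ?H' n) \<union> (?H' n - T interior_of ?H' n))"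
    proof (intro meager_in_UN meager_in_Un)
      fix n
      show "meager_in T (S' n - ?H' n)"
        using S by (intro meager_in_diff_meager_hull T) auto
      show "meager_in T (?H' n - T interior_of ?H' n)"
        by (intro meager_in_nowhere_dense nowhere_dense_in_closed_diff_interior closedin_meager_hull)
    qed auto
    moreover have "G \<subseteq> T closure_of G"
      using G by (simp add: closure_of_subset openin_subset)
    ultimately show ?thesis
      by (elim meager_in_subset) (auto simp: V_def S G_def)
  qed
  then have "V \<inter> ?H = {}"
    using V by (auto simp: meager_hull_def)
  then have "V = {}"
    using interior_of_subset[of T ?H] by (auto simp: V_def)
  moreover have "G \<subseteq> (\<Union>n. ?H' n)"
    unfolding G_def by (intro UN_mono interior_of_subset) auto
  ultimately have sub: "?H - (\<Union>n. ?H' n) \<subseteq> (?H - T interior_of ?H) \<union> (T closure_of G - G)"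
    unfolding V_def by blast
  have "meager_in T ((?H - T interior_of ?H) \<union> (T closure_of G - G))"
    by (intro meager_in_Un meager_in_nowhere_dense nowhere_dense_in_closed_diff_interior
        closedin_meager_hull nowhere_dense_in_closure_diff_open G)
  then show ?thesis using sub by (rule meager_in_subset)
qed

lemma openin_Baire_space_cylinder:
  assumes "openin Baire_space U" "b \<in> U"
  obtains n where "\<And>b'. (\<And>i. i < n \<Longrightarrow> b' i = b i) \<Longrightarrow> b' \<in> U"
proof -
  obtain V where V: "finite {i \<in> UNIV. V i \<noteq> topspace (discrete_topology (UNIV::nat set))}"
    "b \<in> Pi\<^sub>E UNIV V" "Pi\<^sub>E UNIV V \<subseteq> U"
    using assms unfolding Baire_space_def openin_product_topology_alt by metis
  define n where "n = Suc (Max {i. V i \<noteq> UNIV})"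
  have "b' \<in> U" if b': "\<And>i. i < n \<Longrightarrow> b' i = b i" for b'
  proof -
    have "b' i \<in> V i" for i
    proof (cases "V i = UNIV")
      case False
      then have "i < n"
        using V(1) by (simp add: n_def le_imp_less_Suc)
      then show ?thesis using b' V(2) by auto
    qed auto
    then show ?thesis using V(3) by auto
  qed
  then show thesis using that by blast
qed

text \<open>A Souslin scheme \<open>A s\<close> for the set is replaced by the closed sets \<open>meager_hull T (A s)\<close>; a point
  that lies on a branch of the latter, outside a meager set, is sent by \<open>F\<close> to the \<open>g\<close>-image of
  that branch.\<close>

lemma nonmeager_analytic_preimage:
  assumes T: "second_countable T" and C: "comeager_in T C"
    and F: "continuous_map (subtopology T C) Z F" and Z: "Hausdorff_space Z"
    and g: "continuous_map Baire_space Z g"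
    and nonmeager: "\<not> meager_in T {u \<in> C. F u \<in> range g}"
  obtains V where "openin T V" "V \<noteq> {}" "meager_in T (V - {u \<in> C. F u \<in> range g})"
proof -
  have CT: "C \<subseteq> topspace T"
    using C by (simp add: comeager_in_def)
  define A where "A s = {u \<in> C. \<exists>b. (\<forall>i<length s. b i = s ! i) \<and> g b = F u}" for s :: "nat list"
  have A_sub: "A s \<subseteq> topspace T" for s
    using CT by (auto simp: A_def)
  have A_split: "A s = (\<Union>n. A (s @ [n]))" for s
  proof (intro equalityI subsetI)
    fix u assume "u \<in> A s"
    then obtain b where "u \<in> C" "\<forall>i<length s. b i = s ! i" "g b = F u"
      by (auto simp: A_def)
    then have "u \<in> A (s @ [b (length s)])"
      by (auto simp: A_def nth_append less_Suc_eq intro!: exI[of _ b])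
    then show "u \<in> (\<Union>n. A (s @ [n]))" by blast
  next
    fix u assume "u \<in> (\<Union>n. A (s @ [n]))"
    then obtain n b where "u \<in> C" "\<forall>i<length (s @ [n]). b i = (s @ [n]) ! i" "g b = F u"
      by (auto simp: A_def)
    moreover from this have "\<forall>i<length s. b i = s ! i"
      by (simp add: nth_append)
    ultimately show "u \<in> A s"
      unfolding A_def by blast
  qed
  let ?H = "\<lambda>s. meager_hull T (A s)"
  \<comment> \<open>A point of \<open>Bad\<close> lies in the hull at some node \<open>s\<close> but
    in the hull at no child of \<open>s\<close>. Outside this meager set a branch through the hulls
    can always be prolonged.\<close>
  define Bad where "Bad = (\<Union>s. ?H s - (\<Union>n. ?H (s @ [n])))"
  have Bad: "meager_in T Bad"
    unfolding Bad_def
    by (intro meager_in_UN meager_in_hull_diff_UN_hull T A_split A_sub) auto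
  have A_Nil: "A [] = {u \<in> C. F u \<in> range g}"
    by (auto simp: A_def image_iff) metis
  have branch: "F u \<in> range g" if u: "u \<in> ?H []" "u \<notin> Bad" "u \<in> C" for u
  proof -
    have "\<exists>n. u \<in> ?H (s @ [n])" if "u \<in> ?H s" for s
      using that u(2) by (auto simp: Bad_def)
    then obtain nx where nx: "\<And>s. u \<in> ?H s \<Longrightarrow> u \<in> ?H (s @ [nx s])"
      by metis
    define br where "br = rec_nat [] (\<lambda>_ s. s @ [nx s])"
    have br: "br 0 = []" "br (Suc n) = br n @ [nx (br n)]" for n
      by (auto simp: br_def)
    have len: "length (br n) = n" for n
      by (induction n) (auto simp: br)
    have u_br: "u \<in> ?H (br n)" for n
      by (induction n) (use u nx in \<open>auto simp: br\<close>)
    define b where "b n = nx (br n)" for n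
    have br_nth: "br n ! i = b i" if "i < n" for n i
      using that by (induction n) (auto simp: br nth_append len b_def less_Suc_eq)
    \<comment> \<open>If the values differed, continuity would give a neighbourhood \<open>N\<close>
      of \<open>u\<close> and a length \<open>n\<close> that keep them apart. But \<open>u\<close>
      lies in the hull at the node \<open>br n\<close>, so \<open>N\<close> meets
      \<open>A (br n)\<close>, in a point whose image would lie in both separating sets.\<close>
    have "F u = g b"
    proof (rule ccontr)
      assume "F u \<noteq> g b"
      moreover have "F u \<in> topspace Z" "g b \<in> topspace Z"
        using F g u(3) CT by (auto simp: continuous_map_def Baire_space_def Pi_iff)
      ultimately obtain P Q where PQ: "openin Z P" "openin Z Q" "F u \<in> P" "g b \<in> Q" "P \<inter> Q = {}"
        using Z unfolding Hausdorff_space_def disjnt_def by metis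
      have "openin (subtopology T C) {x \<in> topspace (subtopology T C). F x \<in> P}"
        using F PQ(1) by (simp add: continuous_map_def)
      then obtain N where N: "openin T N" "{x \<in> topspace (subtopology T C). F x \<in> P} = N \<inter> C"
        by (auto simp: openin_subtopology)
      have uN: "u \<in> N"
        using N(2) PQ(3) u(3) CT by auto
      have "openin Baire_space {x \<in> topspace Baire_space. g x \<in> Q}"
        using g PQ(2) by (simp add: continuous_map_def)
      moreover have "b \<in> {x \<in> topspace Baire_space. g x \<in> Q}"
        using PQ(4) by (simp add: Baire_space_def)
      ultimately obtain n where n: "\<And>b'. (\<And>i. i < n \<Longrightarrow> b' i = b i) \<Longrightarrow> g b' \<in> Q"
        using openin_Baire_space_cylinder by (metis (no_types, lifting) mem_Collect_eq)
      have "N \<inter> A (br n) \<noteq> {}"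
        using u_br[of n] N(1) uN by (auto simp: meager_hull_def meager_in_empty)
      then obtain u' b' where "u' \<in> N \<inter> C" "\<forall>i<n. b' i = br n ! i" "g b' = F u'"
        by (auto simp: A_def len)
      then show False
        using n[of b'] br_nth PQ(5) N(2) by auto
    qed
    then show ?thesis by simp
  qed
  define V where "V = T interior_of (?H [])"
  have "meager_in T ((topspace T - C) \<union> Bad)"
    using C Bad by (intro meager_in_Un) (auto simp: comeager_in_def)
  moreover have "V \<subseteq> ?H []" "?H [] \<subseteq> topspace T"
    by (auto simp: V_def interior_of_subset meager_hull_def)
  ultimately have V: "meager_in T (V - {u \<in> C. F u \<in> range g})"
    using branch by (elim meager_in_subset) auto
  have "V \<noteq> {}"
  proof
    assume "V = {}"
    then have "nowhere_dense_in T (?H [])"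
      using nowhere_dense_in_closed_diff_interior[OF closedin_meager_hull] by (metis V_def Diff_empty)
    then have "meager_in T ((A [] - ?H []) \<union> ?H [])"
      by (intro meager_in_Un meager_in_diff_meager_hull T A_sub meager_in_nowhere_dense)
    then show False
      using nonmeager unfolding A_Nil by (auto elim: notE meager_in_subset)
  qed
  moreover have "openin T V"
    by (simp add: V_def)
  ultimately show thesis
    using that V by blast
qed

section \<open>Products of Cantor space\<close>

text \<open>Through the instances for function and product types, this makes \<open>seqs\<close> and
  \<open>seqs \<times> seqs\<close> second countable.\<close>

instance bool :: second_countable_topology
proof
  have "open = generate_topology (UNIV :: bool set set)"
    by (auto simp: fun_eq_iff open_discrete intro: generate_topology.Basis)
  then show "\<exists>B::bool set set. countable B \<and> open = generate_topology B"
    by (metis countable_finite finite)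
qed

lemma second_countable_euclidean:
  "second_countable (euclidean :: 'a::second_countable_topology topology)"
proof -
  obtain \<B> :: "'a set set" where \<B>: "countable \<B>" "\<And>C. C \<in> \<B> \<Longrightarrow> open C"
    "\<And>S. open S \<Longrightarrow> \<exists>U. U \<subseteq> \<B> \<and> S = \<Union>U"
    using univ_second_countable by blast
  have "\<exists>V\<in>\<B>. x \<in> V \<and> V \<subseteq> U" if "open U" "x \<in> U" for U x
    using \<B>(3)[OF that(1)] that(2) by blast
  then show ?thesis
    unfolding second_countable_def using \<B>(1,2) by (intro exI[of _ \<B>]) simp
qed

type_synonym seqs = "nat \<Rightarrow> nat \<Rightarrow> bool"

lemma Cantor_space_eq_euclidean: "Cantor_space = euclidean"
proof -
  have "discrete_topology (UNIV :: bool set) = euclidean"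
    by (simp add: topology_eq open_discrete)
  then show ?thesis
    by (simp add: Cantor_space_def euclidean_product_topology)
qed

lemma Cantor_power_UNIV_eq_euclidean: "Cantor_power UNIV = euclidean"
  by (simp add: Cantor_power_def Cantor_space_eq_euclidean euclidean_product_topology)

lemma completely_metrizable_seqs: "completely_metrizable_space (euclidean :: seqs topology)"
proof -
  have "completely_metrizable_space (Cantor_power (UNIV :: nat set))"
    unfolding Cantor_power_def Cantor_space_def
    by (simp add: completely_metrizable_space_product_topology completely_metrizable_space_discrete_topology)
  then show ?thesis by (simp add: Cantor_power_UNIV_eq_euclidean)
qed

lemma continuous_on_bool_coordinate:
  fixes P :: "bool \<Rightarrow> 'a::topological_space"
  shows "continuous_on UNIV (\<lambda>x::seqs. P (x i m))"
proof -
  have "continuous_on UNIV (\<lambda>x::seqs. x i)"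
    by (rule continuous_on_product_then_coordinatewise[OF continuous_on_id])
  then have "continuous_on UNIV (\<lambda>x::seqs. x i m)"
    by (rule continuous_on_product_then_coordinatewise)
  moreover have "continuous_on UNIV P"
    by simp
  ultimately show ?thesis
    using continuous_on_compose2[of UNIV P UNIV "\<lambda>x. x i m"] by auto
qed

text \<open>The pairing function lists all entries of a double sequence in one order of type omega.
  Hence a single number measures a cylinder, and the blocks of the fusion argument are intervals of
  codes.\<close>

definition agree :: "nat \<Rightarrow> seqs \<Rightarrow> seqs \<Rightarrow> bool" where
  "agree n x y \<longleftrightarrow> (\<forall>i m. prod_encode (i, m) < n \<longrightarrow> x i m = y i m)"

lemma agree_mono: "agree n x y \<Longrightarrow> m \<le> n \<Longrightarrow> agree m x y"
  by (auto simp: agree_def)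

lemma open_bool_fun_contains_cylinder:
  assumes "open U" "a \<in> U"
  obtains n where "\<And>b :: nat \<Rightarrow> bool. (\<And>j. j < n \<Longrightarrow> b j = a j) \<Longrightarrow> b \<in> U"
proof -
  obtain V where V: "finite {i. V i \<noteq> UNIV}" "a \<in> Pi\<^sub>E UNIV V" "Pi\<^sub>E UNIV V \<subseteq> U"
    using assms[unfolded open_fun_def openin_product_topology_alt] that by auto
  obtain n where n: "{i. V i \<noteq> UNIV} \<subseteq> {..<n}"
    using V(1) finite_nat_iff_bounded by blast
  have "b \<in> U" if "\<And>j. j < n \<Longrightarrow> b j = a j" for b
  proof -
    have "b j \<in> V j" for j
    proof (cases "j < n")
      case True
      then show ?thesis using V(2) that by auto
    next
      case False
      then have "V j = UNIV" using n by auto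
      then show ?thesis by simp
    qed
    then show ?thesis using V(3) by auto
  qed
  then show thesis using that by blast
qed

lemma open_seqs_contains_cylinder:
  assumes "open U" "x \<in> U"
  obtains n where "\<And>y. agree n x y \<Longrightarrow> y \<in> U"
proof -
  obtain V where V: "finite {i. V i \<noteq> UNIV}" "\<And>i. open (V i)" "x \<in> Pi\<^sub>E UNIV V" "Pi\<^sub>E UNIV V \<subseteq> U"
    using assms[unfolded open_fun_def[where 'a=nat and 'b="nat \<Rightarrow> bool"] openin_product_topology_alt]
    by auto
  have "\<exists>n. \<forall>b. (\<forall>j<n. b j = x i j) \<longrightarrow> b \<in> V i" for i
    using open_bool_fun_contains_cylinder[OF V(2)[of i], of "x i"] V(3)
    by (metis PiE_mem UNIV_I)
  then obtain N where N: "\<And>i b. (\<And>j. j < N i \<Longrightarrow> b j = x i j) \<Longrightarrow> b \<in> V i"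
    by metis
  have "finite (prod_encode ` (SIGMA i:{i. V i \<noteq> UNIV}. {..<N i}))"
    using V(1) by auto
  then obtain n where n: "prod_encode ` (SIGMA i:{i. V i \<noteq> UNIV}. {..<N i}) \<subseteq> {..<n}"
    using finite_nat_iff_bounded by blast
  have "y \<in> U" if "agree n x y" for y
  proof -
    have "y i \<in> V i" for i
    proof (cases "V i = UNIV")
      case False
      then have "prod_encode (i, j) < n" if "j < N i" for j
        using n that by auto
      then show ?thesis
        using N \<open>agree n x y\<close> by (auto simp: agree_def)
    qed auto
    then show ?thesis using V(4) by auto
  qed
  then show thesis using that by blast
qed

lemma open_seqs_prod_contains_cylinder:
  assumes "open U" "(x, y) \<in> U"
  obtains n where "\<And>x' y'. agree n x x' \<Longrightarrow> agree n y y' \<Longrightarrow> (x', y') \<in> U"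
proof -
  obtain A B where AB: "open A" "open B" "(x, y) \<in> A \<times> B" "A \<times> B \<subseteq> U"
    using assms open_prod_def[of U] by metis
  then obtain n where n: "\<And>x'. agree n x x' \<Longrightarrow> x' \<in> A"
    using open_seqs_contains_cylinder[of A x] by blast
  obtain m where m: "\<And>y'. agree m y y' \<Longrightarrow> y' \<in> B"
    using open_seqs_contains_cylinder[of B y] AB by blast
  show thesis
    using that[of "max n m"] AB(4) n m agree_mono[of "max n m"] by (metis max.cobounded1 max.cobounded2 mem_Sigma_iff subsetD)
qed

section \<open>Finite changes and the topological 0-1 law\<close>

text \<open>Addition modulo 2 of the indicator of \<open>A\<close>. It is an involution, and finite
  sets \<open>A\<close> suffice to move any point into any given cylinder.\<close>

definition flip :: "(nat \<times> nat) set \<Rightarrow> seqs \<Rightarrow> seqs" where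
  "flip A x = (\<lambda>i m. x i m \<noteq> ((i, m) \<in> A))"

lemma flip_flip [simp]: "flip A (flip A x) = x"
  by (auto simp: flip_def)

lemma continuous_on_flip: "continuous_on UNIV (flip A)"
  unfolding flip_def
  by (intro continuous_on_coordinatewise_then_product continuous_on_bool_coordinate)

definition flip2 :: "(nat \<times> nat) set \<times> (nat \<times> nat) set \<Rightarrow> seqs \<times> seqs \<Rightarrow> seqs \<times> seqs" where
  "flip2 AB = map_prod (flip (fst AB)) (flip (snd AB))"

lemma flip2_flip2 [simp]: "flip2 AB (flip2 AB p) = p"
  by (cases p) (simp add: flip2_def)

lemma homeomorphic_map_flip2: "homeomorphic_map euclidean euclidean (flip2 AB)"
proof -
  have "continuous_on UNIV (flip2 AB)"
    unfolding flip2_def map_prod_def case_prod_beta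
    by (intro continuous_intros continuous_on_compose2[OF continuous_on_flip]) auto
  then have "homeomorphic_maps euclidean euclidean (flip2 AB) (flip2 AB)"
    by (auto simp: homeomorphic_maps_def)
  then show ?thesis
    by (rule homeomorphic_maps_map[THEN iffD1, THEN conjunct1])
qed

lemma agree_flip_finite:
  obtains A where "finite A" "A \<subseteq> {p. prod_encode p < n}" "agree n x (flip A y)"
proof -
  let ?A = "{(i, m). prod_encode (i, m) < n \<and> x i m \<noteq> y i m}"
  have "finite (prod_encode -` {..<n})"
    by (intro finite_vimageI inj_prod_encode) auto
  then have "finite ?A"
    by (rule rev_finite_subset) auto
  then show thesis
    using that[of ?A] by (auto simp: agree_def flip_def)
qed

text \<open>The topological 0-1 law for the group of finite changes of both coordinates.\<close>

lemma flip2_invariant_analytic_meager_or_comeager: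
  fixes S :: "(seqs \<times> seqs) set"
  assumes Y: "second_countable Y" "Hausdorff_space Y"
    and E: "analytic_in (prod_topology Y Y) E"
    and G: "Borel_map euclidean Y G1" "Borel_map euclidean Y G2"
    and S: "S = {p. (G1 p, G2 p) \<in> E}"
    and inv: "\<And>A B p. finite A \<Longrightarrow> finite B \<Longrightarrow> p \<in> S \<Longrightarrow> flip2 (A, B) p \<in> S"
  shows "meager_in euclidean S \<or> comeager_in euclidean S"
proof (cases "meager_in euclidean S")
  case False
  \<comment> \<open>Nonemptiness excludes the degenerate clause of \<open>analytic_in\<close>,
    leaving a continuous map from the Baire space onto \<open>E\<close>.\<close>
  have "E \<noteq> {}"
    using False S by (auto simp: meager_in_empty)
  then obtain g where g: "continuous_map Baire_space (prod_topology Y Y) g" "range g = E"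
    using E by (auto simp: analytic_in_def Baire_space_def)
  obtain C1 C2 where C1: "comeager_in euclidean C1" "continuous_map (subtopology euclidean C1) Y G1"
    and C2: "comeager_in euclidean C2" "continuous_map (subtopology euclidean C2) Y G2"
    using Borel_map_continuous_on_comeager G Y(1) by metis
  have C: "comeager_in euclidean (C1 \<inter> C2)"
    using C1(1) C2(1) by (simp add: comeager_in_def Diff_Int meager_in_Un)
  have cont: "continuous_map (subtopology euclidean (C1 \<inter> C2)) (prod_topology Y Y) (\<lambda>p. (G1 p, G2 p))"
    using C1(2) C2(2) by (intro continuous_map_pairedI) (auto intro: continuous_map_from_subtopology_mono)
  have nonmeager: "\<not> meager_in euclidean {u \<in> C1 \<inter> C2. (G1 u, G2 u) \<in> range g}"
  proof
    assume "meager_in euclidean {u \<in> C1 \<inter> C2. (G1 u, G2 u) \<in> range g}"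
    then have "meager_in euclidean ({u \<in> C1 \<inter> C2. (G1 u, G2 u) \<in> range g} \<union> (UNIV - C1 \<inter> C2))"
      using C by (intro meager_in_Un) (auto simp: comeager_in_def)
    then have "meager_in euclidean S"
      by (rule meager_in_subset) (auto simp: S g(2))
    then show False
      using False by contradiction
  qed
  have "Hausdorff_space (prod_topology Y Y)"
    using Y(2) by (simp add: Hausdorff_space_prod_topology)
  from nonmeager_analytic_preimage[OF second_countable_euclidean C cont this g(1) nonmeager]
  obtain V where "openin euclidean V" and V: "V \<noteq> {}"
    "meager_in euclidean (V - {u \<in> C1 \<inter> C2. (G1 u, G2 u) \<in> range g})"
    .
  then have openV: "open V"
    by simp
  from V have VS: "meager_in euclidean (V - S)"
    by (elim meager_in_subset) (auto simp: S g(2))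
  obtain q r where qr: "(q, r) \<in> V"
    using V(1) by auto
  obtain n where n: "\<And>x' y'. agree n q x' \<Longrightarrow> agree n r y' \<Longrightarrow> (x', y') \<in> V"
    using open_seqs_prod_contains_cylinder[OF openV qr] by metis
  let ?I = "{A. finite A} \<times> {B. finite B}"
  have "meager_in euclidean (\<Union>AB\<in>?I. flip2 AB ` (V - S))"
    using VS homeomorphic_map_flip2
    by (intro meager_in_UN homeomorphic_map_meager_in countable_SIGMA countable_Collect_finite) auto
  \<comment> \<open>A finite change moves \<open>p\<close> into \<open>V\<close>, and invariance
    keeps it outside \<open>S\<close>. The covering union is meager because there are only countably
    many pairs of finite sets and the flips are homeomorphisms.\<close>
  moreover have "UNIV - S \<subseteq> (\<Union>AB\<in>?I. flip2 AB ` (V - S))"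
  proof
    fix p assume p: "p \<in> UNIV - S"
    obtain A B where AB: "finite A" "agree n q (flip A (fst p))" "finite B" "agree n r (flip B (snd p))"
      using agree_flip_finite by metis
    then have "flip2 (A, B) p \<in> V"
      using n by (cases p) (auto simp: flip2_def)
    moreover have "flip2 (A, B) p \<notin> S"
      using inv[OF AB(1,3), of "flip2 (A, B) p"] p by auto
    ultimately have "p \<in> flip2 (A, B) ` (V - S)"
      using flip2_flip2[of "(A, B)" p] by (metis Diff_iff image_eqI)
    then show "p \<in> (\<Union>AB\<in>?I. flip2 AB ` (V - S))"
      using AB by blast
  qed
  ultimately have "meager_in euclidean (UNIV - S)"
    by (rule meager_in_subset)
  then show ?thesis by (simp add: comeager_in_def)
qed simp

section \<open>Kuratowski--Ulam for comeager sets\<close>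

lemma closure_UNIV_iff: "closure S = UNIV \<longleftrightarrow> (\<forall>V. open V \<and> V \<noteq> {} \<longrightarrow> S \<inter> V \<noteq> {})"
  using dense_intersects_open[of euclidean S] by (auto simp: euclidean_closure_of)

text \<open>Density of a section is tested on a countable base of the first factor. Each test
  succeeds for a dense open set \<open>W (n, B)\<close> of points \<open>y\<close>, openness holding
  because projections are open maps. Baire category yields one \<open>y\<close> that passes all
  tests.\<close>

lemma comeager_in_section:
  fixes S :: "('a::second_countable_topology \<times> 'b::topological_space) set"
  assumes b: "completely_metrizable_space (euclidean :: 'b topology)"
    and S: "comeager_in euclidean S"
  shows "\<exists>y. comeager_in euclidean {x. (x, y) \<in> S}"
proof -
  obtain U where U: "\<And>n::nat. open (U n)" "\<And>n. closure (U n) = UNIV" "(\<Inter>n. U n) \<subseteq> S"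
    using comeager_in_open_dense_sequence[OF S] by (metis euclidean_closure_of open_openin topspace_euclidean)
  obtain \<B> :: "'a set set" where \<B>: "countable \<B>" "\<And>C. C \<in> \<B> \<Longrightarrow> open C"
    "\<And>S. open S \<Longrightarrow> \<exists>U. U \<subseteq> \<B> \<and> S = \<Union>U"
    using univ_second_countable by blast
  define W where "W = (\<lambda>(n, B). snd ` (U n \<inter> B \<times> UNIV))"
  let ?\<G> = "W ` (UNIV \<times> (\<B> - {{}}))"
  have W: "open (W (n, B)) \<and> closure (W (n, B)) = UNIV" if B: "B \<in> \<B>" "B \<noteq> {}" for n B
  proof
    have op: "open (U n \<inter> B \<times> UNIV)"
      using U(1) \<B>(2) B by (intro open_Int open_Times) auto
    then show "open (W (n, B))"
      unfolding W_def by (simp add: open_image_snd)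
    have "W (n, B) \<inter> V \<noteq> {}" if V: "open V" "V \<noteq> {}" for V
    proof -
      have "open (B \<times> V)" "B \<times> V \<noteq> {}"
        using V B \<B>(2) by (auto intro: open_Times)
      then have "B \<times> V \<inter> U n \<noteq> {}"
        using U(2)[of n] by (metis inf_top.right_neutral open_Int_closure_eq_empty)
      then show ?thesis
        by (force simp: W_def)
    qed
    then show "closure (W (n, B)) = UNIV"
      by (simp add: closure_UNIV_iff)
  qed
  have "euclidean closure_of \<Inter>?\<G> = topspace euclidean"
    using b W \<B>(1) by (intro Baire_category) auto
  \<comment> \<open>A dense subset of a whole type is nonempty, since the type is.\<close>
  then have "\<Inter>?\<G> \<noteq> {}"
    by (metis UNIV_not_empty closure_of_empty topspace_euclidean)
  then obtain y where "y \<in> \<Inter>?\<G>"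
    by blast
  then have "y \<in> W (n, B)" if "B \<in> \<B>" "B \<noteq> {}" for n B
    using that by blast
  then have y: "\<exists>x\<in>B. (x, y) \<in> U n" if "B \<in> \<B>" "B \<noteq> {}" for n B
    using that by (force simp: W_def)
  have "comeager_in euclidean {x. (x, y) \<in> S}"
  proof (rule comeager_in_INT_open_dense[where I = UNIV and U = "\<lambda>n. {x. (x, y) \<in> U n}"])
    fix n :: nat
    have "open ((\<lambda>x. (x, y)) -` U n)"
      using U(1) by (intro open_vimage continuous_intros) auto
    then show "openin euclidean {x. (x, y) \<in> U n}"
      by (simp add: vimage_def)
    have "{x. (x, y) \<in> U n} \<inter> V \<noteq> {}" if V: "open V" "V \<noteq> {}" for V
    proof -
      obtain B where "B \<in> \<B>" "B \<noteq> {}" "B \<subseteq> V"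
        using \<B>(3)[OF V(1)] V(2) by blast
      then show ?thesis using y[of B n] by auto
    qed
    then show "euclidean closure_of {x. (x, y) \<in> U n} = topspace euclidean"
      by (auto simp: closure_UNIV_iff)
  qed (use U(3) in auto)
  then show ?thesis by blast
qed

section \<open>The fusion argument\<close>

text \<open>Below \<open>L\<close> only finitely many patterns are possible, so intersecting the
  images of \<open>U\<close> under all flips below \<open>L\<close> still gives a dense open set. A
  cylinder inside it supplies the entries of the block. Any pair with these entries is moved into
  the cylinder by a flip below \<open>L\<close>, and undoing the flip leads back into
  \<open>U\<close>.\<close>

lemma dense_open_contains_block:
  fixes U :: "(seqs \<times> seqs) set"
  assumes U: "open U" "closure U = UNIV"
  shows "\<exists>M w z. L < M \<and> (\<forall>x y.
    (\<forall>i m. L \<le> prod_encode (i, m) \<and> prod_encode (i, m) < M \<longrightarrow> x i m = w i m \<and> y i m = z i m)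
      \<longrightarrow> (x, y) \<in> U)"
proof -
  define P where "P = Pow {p. prod_encode p < L}"
  have "finite (prod_encode -` {..<L})"
    by (intro finite_vimageI inj_prod_encode) auto
  then have P: "finite P" "P \<noteq> {}"
    by (auto simp: P_def vimage_def)
  define V where "V = (\<Inter>AB\<in>P \<times> P. flip2 AB ` U)"
  have "openin euclidean V \<and> euclidean closure_of V = topspace euclidean"
    unfolding V_def
  proof (intro dense_open_INT conjI)
    fix AB
    have "euclidean closure_of (flip2 AB ` U) = flip2 AB ` (euclidean closure_of U)"
      by (intro homeomorphic_map_closure_of homeomorphic_map_flip2) auto
    also have "\<dots> = topspace euclidean"
      using U(2) homeomorphic_imp_surjective_map[OF homeomorphic_map_flip2, of AB] by simp
    finally show "euclidean closure_of (flip2 AB ` U) = topspace euclidean" .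
    show "openin euclidean (flip2 AB ` U)"
      using U(1) homeomorphic_map_openness[OF homeomorphic_map_flip2, of U AB] by simp
  qed (use P in auto)
  then have V: "open V" "V \<noteq> {}"
    by auto
  then obtain w z where wz: "(w, z) \<in> V"
    by auto
  obtain n where n: "\<And>x y. agree n w x \<Longrightarrow> agree n z y \<Longrightarrow> (x, y) \<in> V"
    using open_seqs_prod_contains_cylinder[OF V(1) wz] by metis
  \<comment> \<open>\<open>Suc\<close> guarantees \<open>L < M\<close> even if \<open>n\<close> is
    at most \<open>L\<close>.\<close>
  define M where "M = Suc (max n L)"
  have "(x, y) \<in> U"
    if xy: "\<And>i m. L \<le> prod_encode (i, m) \<Longrightarrow> prod_encode (i, m) < M \<Longrightarrow> x i m = w i m \<and> y i m = z i m"
    for x y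
  proof -
    obtain A where A: "A \<subseteq> {p. prod_encode p < L}" "agree L w (flip A x)"
      using agree_flip_finite by metis
    obtain B where B: "B \<subseteq> {p. prod_encode p < L}" "agree L z (flip B y)"
      using agree_flip_finite by metis
    have agree_flip: "agree n w' (flip A' x')"
      if "A' \<subseteq> {p. prod_encode p < L}" "agree L w' (flip A' x')"
        "\<And>i m. L \<le> prod_encode (i, m) \<Longrightarrow> prod_encode (i, m) < M \<Longrightarrow> x' i m = w' i m" for A' w' x'
      unfolding agree_def
    proof (intro allI impI)
      fix i m assume im: "prod_encode (i, m) < n"
      show "w' i m = flip A' x' i m"
      proof (cases "prod_encode (i, m) < L")
        case True
        then show ?thesis using that(2) by (simp add: agree_def)
      next
        case False
        then have "(i, m) \<notin> A'" "x' i m = w' i m"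
          using that(1,3) im by (auto simp: M_def)
        then show ?thesis by (simp add: flip_def)
      qed
    qed
    have "agree n w (flip A x)" "agree n z (flip B y)"
      using A B xy by (auto intro: agree_flip)
    then have "flip2 (A, B) (x, y) \<in> V"
      using n by (simp add: flip2_def)
    then have "flip2 (A, B) (x, y) \<in> flip2 (A, B) ` U"
      using A(1) B(1) by (auto simp: V_def P_def)
    then show ?thesis
      by (metis flip2_flip2 imageE)
  qed
  then show ?thesis
    by (intro exI[of _ M] exI[of _ w] exI[of _ z]) (auto simp: M_def)
qed

definition mix :: "nat \<Rightarrow> seqs \<Rightarrow> seqs \<Rightarrow> seqs" where
  "mix k x y = (\<lambda>i. if i < k then x i else y i)"

lemma E0_iff_finite: "(a, b) \<in> E0 \<longleftrightarrow> finite {n. a n \<noteq> b n}"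
proof
  assume "(a, b) \<in> E0"
  then obtain m where "\<forall>n\<ge>m. a n = b n"
    by (auto simp: E0_def)
  then have "{n. a n \<noteq> b n} \<subseteq> {..<m}"
    by (auto simp: not_le[symmetric])
  then show "finite {n. a n \<noteq> b n}"
    using finite_subset by blast
next
  assume "finite {n. a n \<noteq> b n}"
  then obtain m where "{n. a n \<noteq> b n} \<subseteq> {..<m}"
    using finite_nat_iff_bounded by blast
  then have "\<forall>n\<ge>m. a n = b n" by auto
  then show "(a, b) \<in> E0"
    by (auto simp: E0_def)
qed

text \<open>The \<open>n\<close>-th bit of the input, in row \<open>fst (prod_decode n)\<close>, chooses between the blocks
  \<open>W n\<close> and \<open>Z n\<close> of the output, but only in rows from \<open>fst (prod_decode n)\<close> on. On the
  remaining rows the second coordinate of \<open>U k n\<close> is fed the fixed point \<open>v\<close> instead.\<close>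

lemma fusion:
  fixes U :: "nat \<Rightarrow> nat \<Rightarrow> (seqs \<times> seqs) set"
  assumes U: "\<And>k n. open (U k n)" "\<And>k n. closure (U k n) = UNIV" "\<And>k. decseq (U k)"
  obtains g v where "continuous_on UNIV g"
    "\<And>x y j. (\<And>i. i \<le> j \<Longrightarrow> (x i, y i) \<in> E0) \<Longrightarrow> (g x j, g y j) \<in> E0"
    "\<And>x y k. (x k, y k) \<notin> E0 \<Longrightarrow>
       (g x, mix k v (g y)) \<in> (\<Inter>n. U k n) \<or> (g y, mix k v (g x)) \<in> (\<Inter>n. U k n)"
proof -
  define row where "row n = fst (prod_decode n)" for n
  define bit where "bit x n = x (row n) (snd (prod_decode n))" for x :: seqs and n
  \<comment> \<open>Writing \<open>w\<close> and \<open>z\<close> on the block \<open>[L, M)\<close>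
    forces a pair into the single set \<open>U (row n) n\<close>. Since \<open>U k\<close> is
    decreasing, infinitely many such successes with \<open>row n = k\<close> give membership in
    every \<open>U k N\<close>.\<close>
  define Q where "Q n L M w z \<longleftrightarrow> L < M \<and> (\<forall>x y.
    (\<forall>i m. L \<le> prod_encode (i, m) \<and> prod_encode (i, m) < M \<longrightarrow> x i m = w i m \<and> y i m = z i m)
      \<longrightarrow> (x, y) \<in> U (row n) n)" for n L M w z
  have "\<exists>M w z. Q n L M w z" for n L
    unfolding Q_def by (rule dense_open_contains_block[OF U(1,2)])
  then obtain M w z where "\<And>n L. Q n L (M n L) (w n L) (z n L)"
    by metis
  then have Mwz: "L < M n L"
    "(\<And>i m. L \<le> prod_encode (i, m) \<Longrightarrow> prod_encode (i, m) < M n L \<Longrightarrow>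
        x i m = w n L i m \<and> y i m = z n L i m) \<Longrightarrow> (x, y) \<in> U (row n) n" for n L x y
    unfolding Q_def by blast+
  \<comment> \<open>Cut points: block \<open>n\<close> is the interval
    \<open>[l n, l (Suc n))\<close> of codes, each block beginning where the previous one
    ended.\<close>
  define l where "l = rec_nat 0 M"
  have l: "l 0 = 0" "l (Suc n) = M n (l n)" for n
    by (auto simp: l_def)
  have "strict_mono l"
    by (simp add: strict_mono_Suc_iff l Mwz(1))
  then have le_l: "n \<le> l n" for n
    by (rule strict_mono_imp_increasing)
  define blk where "blk c = (LEAST n. c < l (Suc n))" for c
  have blk_less: "c < l (Suc (blk c))" for c
    unfolding blk_def by (rule LeastI[of _ c]) (use le_l[of "Suc c"] in auto)
  have blk_eq: "blk c = n" if "l n \<le> c" "c < l (Suc n)" for c n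
    unfolding blk_def
  proof (rule Least_equality)
    fix m assume "c < l (Suc m)"
    then have "l n < l (Suc m)" using that by simp
    then show "n \<le> m"
      using \<open>strict_mono l\<close> by (simp add: strict_mono_less)
  qed (rule that)
  define W Z where "W n = w n (l n)" and "Z n = z n (l n)" for n
  define g where "g x = (\<lambda>i m. let n = blk (prod_encode (i, m)) in
    if bit x n \<and> row n \<le> i then Z n i m else W n i m)" for x
  define v where "v = (\<lambda>i m. Z (blk (prod_encode (i, m))) i m)"
  have "continuous_on UNIV g"
    unfolding g_def bit_def Let_def
    by (intro continuous_on_coordinatewise_then_product
        continuous_on_bool_coordinate[where P = "\<lambda>b. if b \<and> _ then _ else _"])
  moreover have "(g x j, g y j) \<in> E0" if x: "\<And>i. i \<le> j \<Longrightarrow> (x i, y i) \<in> E0" for x y j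
  proof -
    \<comment> \<open>An entry in row \<open>j\<close> depends on bit \<open>n\<close> only when
      \<open>row n \<le> j\<close>. Such bits come from finitely many input rows, in each of which
      \<open>x\<close> and \<open>y\<close> differ finitely often.\<close>
    have "{n. row n \<le> j \<and> bit x n \<noteq> bit y n}
        \<subseteq> prod_encode ` (SIGMA i:{..j}. {m. x i m \<noteq> y i m})"
    proof
      fix n assume "n \<in> {n. row n \<le> j \<and> bit x n \<noteq> bit y n}"
      then have "prod_decode n \<in> (SIGMA i:{..j}. {m. x i m \<noteq> y i m})"
        by (cases "prod_decode n") (auto simp: row_def bit_def)
      then show "n \<in> prod_encode ` (SIGMA i:{..j}. {m. x i m \<noteq> y i m})"
        by (rule rev_image_eqI) simp
    qed
    moreover have "finite (prod_encode ` (SIGMA i:{..j}. {m. x i m \<noteq> y i m}))"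
      using x by (auto simp: E0_iff_finite)
    ultimately have fin: "finite {n. row n \<le> j \<and> bit x n \<noteq> bit y n}"
      by (rule finite_subset)
    have "{m. g x j m \<noteq> g y j m} \<subseteq> (\<Union>n\<in>{n. row n \<le> j \<and> bit x n \<noteq> bit y n}. {..<l (Suc n)})"
    proof
      fix m assume m: "m \<in> {m. g x j m \<noteq> g y j m}"
      let ?n = "blk (prod_encode (j, m))"
      have "row ?n \<le> j \<and> bit x ?n \<noteq> bit y ?n"
        using m by (auto simp: g_def Let_def split: if_splits)
      moreover have "m < l (Suc ?n)"
        using blk_less le_prod_encode_2 le_less_trans by blast
      ultimately show "m \<in> (\<Union>n\<in>{n. row n \<le> j \<and> bit x n \<noteq> bit y n}. {..<l (Suc n)})"
        by blast
    qed
    then show ?thesis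
      unfolding E0_iff_finite by (rule finite_subset) (use fin in auto)
  qed
  moreover have "(g x, mix k v (g y)) \<in> (\<Inter>n. U k n) \<or> (g y, mix k v (g x)) \<in> (\<Inter>n. U k n)"
    if xy: "(x k, y k) \<notin> E0" for x y k
  proof -
    \<comment> \<open>On block \<open>n\<close> the point \<open>g x\<close> is \<open>W n\<close>.
      The second point is \<open>Z n\<close> throughout: in rows from \<open>row n\<close> on
      because \<open>bit y n\<close> holds, in lower rows because \<open>v\<close> copies
      \<open>Z\<close>.\<close>
    have meet: "(g x, mix (row n) v (g y)) \<in> U (row n) n" if "\<not> bit x n" "bit y n" for x y n
      by (rule Mwz(2)[of "l n"])
        (use that in \<open>auto simp: g_def mix_def v_def Let_def W_def Z_def blk_eq l\<close>)
    have all: "(g x, mix k v (g y)) \<in> (\<Inter>n. U k n)"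
      if inf: "infinite {n. row n = k \<and> \<not> bit x n \<and> bit y n}" for x y
    proof
      fix N
      obtain n where "N \<le> n" "row n = k" "\<not> bit x n" "bit y n"
        using inf unfolding infinite_nat_iff_unbounded_le by blast
      then have "(g x, mix k v (g y)) \<in> U k n"
        using meet by blast
      then show "(g x, mix k v (g y)) \<in> U k N"
        using U(3) \<open>N \<le> n\<close> unfolding decseq_def by blast
    qed
    \<comment> \<open>Among infinitely many disagreements in row \<open>k\<close>, infinitely many
      have the same orientation; which one is unknown, hence the disjunction in the
      conclusion.\<close>
    have "infinite ((\<lambda>m. prod_encode (k, m)) ` {m. x k m \<noteq> y k m})"
      using xy by (subst finite_image_iff) (auto simp: E0_iff_finite inj_on_def prod_encode_eq)
    moreover have "(\<lambda>m. prod_encode (k, m)) ` {m. x k m \<noteq> y k m}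
        \<subseteq> {n. row n = k \<and> \<not> bit x n \<and> bit y n} \<union> {n. row n = k \<and> \<not> bit y n \<and> bit x n}"
      by (auto simp: row_def bit_def)
    ultimately have "infinite {n. row n = k \<and> \<not> bit x n \<and> bit y n} \<or>
        infinite {n. row n = k \<and> \<not> bit y n \<and> bit x n}"
      using finite_subset by blast
    then show ?thesis using all by blast
  qed
  ultimately show thesis by (rule that)
qed

section \<open>The dichotomy\<close>

lemma Polish_space_imp_second_countable:
  assumes "Polish_space Y"
  shows "second_countable Y"
proof -
  obtain M d where M: "Metric_space M d" "Y = Metric_space.mtopology M d"
    using assms by (auto simp: Polish_space_def completely_metrizable_space_def)
  interpret Metric_space M d by fact
  obtain C where C: "countable C" "C \<subseteq> M" "mtopology closure_of C = M"
    using assms M(2) by (auto simp: Polish_space_def separable_space_def)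
  let ?\<B> = "(\<lambda>(c, n). mball c (inverse (Suc n))) ` (C \<times> (UNIV :: nat set))"
  have "\<exists>V\<in>?\<B>. x \<in> V \<and> V \<subseteq> U" if U: "openin mtopology U" "x \<in> U" for U x
  proof -
    obtain r where r: "r > 0" "mball x r \<subseteq> U" "x \<in> M"
      using U by (metis openin_mtopology subsetD)
    obtain n where n: "inverse (real (Suc n)) < r / 2"
      using reals_Archimedean[of "r / 2"] r(1) by auto
    have "C \<inter> mball x (inverse (Suc n)) \<noteq> {}"
    proof -
      have "x \<in> mball x (inverse (Suc n))"
        using r(3) by (simp add: add_pos_nonneg)
      then have "mball x (inverse (Suc n)) \<noteq> {}"
        by blast
      then show ?thesis
        using dense_intersects_open[of mtopology C] C(3) by simp
    qed
    then obtain c where c: "c \<in> C" "c \<in> M" "d x c < inverse (Suc n)"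
      by auto
    have "mball c (inverse (Suc n)) \<subseteq> mball x r"
    proof
      fix y assume "y \<in> mball c (inverse (Suc n))"
      then have "y \<in> M" "d c y < inverse (Suc n)" by auto
      then show "y \<in> mball x r"
        using triangle[of x c y] c n r(3) by auto
    qed
    moreover have "x \<in> mball c (inverse (Suc n))"
      using c r(3) by (simp add: commute)
    ultimately show ?thesis
      using c(1) r(2) by (intro bexI[of _ "mball c (inverse (Suc n))"]) auto
  qed
  then show ?thesis
    unfolding second_countable_def M(2) using C(1) by (intro exI[of _ ?\<B>]) auto
qed

lemma Borel_map_compose_continuous:
  assumes "continuous_map X X' p" "Borel_map X' Y f"
  shows "Borel_map X Y (\<lambda>x. f (p x))"
proof -
  have "p \<in> borel_of X \<rightarrow>\<^sub>M borel_of X'"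
    unfolding borel_of_def[of X']
  proof (rule measurable_measure_of)
    show "{U. openin X' U} \<subseteq> Pow (topspace X')"
      using openin_subset by auto
    show "p \<in> space (borel_of X) \<rightarrow> topspace X'"
      using assms(1) by (auto simp: space_borel_of continuous_map_def)
    fix U assume "U \<in> {U. openin X' U}"
    then have "openin X {x \<in> topspace X. p x \<in> U}"
      using assms(1) by (simp add: continuous_map_def)
    then show "p -` U \<inter> space (borel_of X) \<in> sets (borel_of X)"
      using openin_imp_sets_borel_of by (simp add: space_borel_of vimage_def Int_def conj_commute)
  qed
  then show ?thesis
    using assms(2) measurable_compose unfolding Borel_map_def by blast
qed

lemma E0_power_UNIV_iff: "(x, y) \<in> E0_power UNIV \<longleftrightarrow> (\<forall>i. (x i, y i) \<in> E0)"
  by (simp add: E0_power_def Cantor_power_UNIV_eq_euclidean)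

lemma E0_refl: "(a, a) \<in> E0"
  by (auto simp: E0_def)

lemma flip_E0:
  assumes "finite A"
  shows "(flip A x i, x i) \<in> E0"
proof -
  have "{m. flip A x i m \<noteq> x i m} \<subseteq> snd ` A"
    by (force simp: flip_def)
  then show ?thesis
    unfolding E0_iff_finite using assms finite_subset by blast
qed

lemma continuous_on_mix: "continuous_on UNIV (\<lambda>p. mix k (fst p) (snd p))"
proof -
  have "continuous_on UNIV (\<lambda>p::seqs \<times> seqs. fst p i)" "continuous_on UNIV (\<lambda>p::seqs \<times> seqs. snd p i)" for i
    by (rule continuous_on_product_then_coordinatewise, intro continuous_intros)+
  then have "continuous_on UNIV (\<lambda>p::seqs \<times> seqs. mix k (fst p) (snd p) i)" for i
    by (cases "i < k") (simp_all add: mix_def)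
  then show ?thesis
    by (rule continuous_on_coordinatewise_then_product)
qed

theorem theorem1p1:
  fixes Y :: "'y topology" and E :: "'y rel"
  assumes "Polish_space Y"
    and "equiv (topspace Y) E"
    and "analytic_in (prod_topology Y Y) E"
  shows "Borel_reducible (Cantor_power (UNIV :: nat set)) (E0_power UNIV) Y E \<or>
    (\<forall>f. Borel_homomorphism (Cantor_power (UNIV :: nat set)) (E0_power UNIV) Y E f \<longrightarrow>
      (\<exists>k :: nat. \<exists>D h.
         comeager_in (Cantor_power {..<k}) D \<and>
         Borel_homomorphism (subtopology (Cantor_power {..<k}) D) (E0_power {..<k}) Y E h \<and>
         comeager_in (Cantor_power (UNIV :: nat set))
           {x \<in> topspace (Cantor_power UNIV). proj k x \<in> D \<and> (h (proj k x), f x) \<in> E}))"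
proof (subst disj_imp, intro allI impI)
  fix f
  assume not_red: "\<not> Borel_reducible (Cantor_power (UNIV :: nat set)) (E0_power UNIV) Y E"
  assume "Borel_homomorphism (Cantor_power (UNIV :: nat set)) (E0_power UNIV) Y E f"
  then have f: "Borel_map euclidean Y f"
    and hom: "\<And>x y. (\<And>i. (x i, y i) \<in> E0) \<Longrightarrow> (f x, f y) \<in> E"
    by (auto simp: Borel_homomorphism_def Cantor_power_UNIV_eq_euclidean E0_power_UNIV_iff)
  have sym: "(b, a) \<in> E" if "(a, b) \<in> E" for a b
    using assms(2) that unfolding equiv_def sym_def by blast
  have trans: "(a, c) \<in> E" if "(a, b) \<in> E" "(b, c) \<in> E" for a b c
    using assms(2) that unfolding equiv_def trans_def by blast
  have Y: "second_countable Y" "Hausdorff_space Y"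
    using assms(1) Polish_space_imp_second_countable completely_metrizable_imp_metrizable_space
      metrizable_imp_Hausdorff_space by (auto simp: Polish_space_def)
  define S where "S k = {p. (f (fst p), f (mix k (fst p) (snd p))) \<in> E}" for k
  have S_cases: "meager_in euclidean (S k) \<or> comeager_in euclidean (S k)" for k
  proof (rule flip2_invariant_analytic_meager_or_comeager[OF Y assms(3)])
    show "Borel_map euclidean Y (\<lambda>p. f (fst p))"
      by (rule Borel_map_compose_continuous[OF _ f]) (simp add: continuous_intros)
    show "Borel_map euclidean Y (\<lambda>p. f (mix k (fst p) (snd p)))"
      by (rule Borel_map_compose_continuous[OF _ f]) (simp add: continuous_on_mix)
    fix A B :: "(nat \<times> nat) set" and p :: "seqs \<times> seqs"
    assume AB: "finite A" "finite B" and p: "p \<in> S k"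
    obtain x y where [simp]: "p = (x, y)" by (cases p)
    have 1: "(f (flip A x), f x) \<in> E"
      by (rule hom) (simp add: flip_E0 AB)
    have 2: "(f (mix k (flip A x) (flip B y)), f (mix k x y)) \<in> E"
      by (rule hom) (simp add: mix_def flip_E0 AB)
    have 3: "(f x, f (mix k x y)) \<in> E"
      using p by (simp add: S_def)
    have "(f (flip A x), f (mix k (flip A x) (flip B y))) \<in> E"
      by (rule trans[OF 1 trans[OF 3 sym[OF 2]]])
    then show "flip2 (A, B) p \<in> S k"
      by (simp add: S_def flip2_def)
  qed (simp add: S_def)
  have "\<exists>k. comeager_in euclidean (S k)"
  proof (rule ccontr)
    assume "\<not> ?thesis"
    then have "comeager_in euclidean (- S k)" for k
      using S_cases[of k] by (simp add: comeager_in_def Diff_eq)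
    note seq = comeager_in_open_dense_sequence[OF this]
    have "\<exists>U. (\<forall>n. open (U n) \<and> closure (U n) = UNIV) \<and> decseq U \<and> (\<Inter>n::nat. U n) \<subseteq> - S k" for k
    proof (rule seq[of k])
      fix U :: "nat \<Rightarrow> (seqs \<times> seqs) set"
      assume "\<And>n. openin euclidean (U n)" "\<And>n. euclidean closure_of U n = topspace euclidean"
        "(\<Inter>n. U n) \<subseteq> - S k" "decseq U"
      then show ?thesis by (intro exI[of _ U]) simp
    qed
    then obtain U where U: "\<And>k n. open (U k n)" "\<And>k n. closure (U k n) = UNIV"
      "\<And>k. decseq (U k)" "\<And>k. (\<Inter>n::nat. U k n) \<subseteq> - S k"
      by metis
    show False
    proof (rule fusion[of U, OF U(1-3)])
      fix g :: "seqs \<Rightarrow> seqs" and v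
      assume g: "continuous_on UNIV g"
        "\<And>x y j. (\<And>i. i \<le> j \<Longrightarrow> (x i, y i) \<in> E0) \<Longrightarrow> (g x j, g y j) \<in> E0"
        "\<And>x y k. (x k, y k) \<notin> E0 \<Longrightarrow>
           (g x, mix k v (g y)) \<in> (\<Inter>n. U k n) \<or> (g y, mix k v (g x)) \<in> (\<Inter>n. U k n)"
      have "(x, y) \<in> E0_power UNIV" if xy: "(f (g x), f (g y)) \<in> E" for x y
      proof (rule ccontr)
        assume "(x, y) \<notin> E0_power UNIV"
        then have ex: "\<exists>k. (x k, y k) \<notin> E0"
          by (simp add: E0_power_UNIV_iff)
        \<comment> \<open>Minimality makes the rows of \<open>g x\<close> and \<open>g y\<close>
          below \<open>k\<close> pairwise \<open>E0\<close>-equivalent.\<close>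
        define k where "k = (LEAST k. (x k, y k) \<notin> E0)"
        have k: "(x k, y k) \<notin> E0"
          unfolding k_def by (rule LeastI_ex[OF ex])
        have "(x i, y i) \<in> E0" if "i < k" for i
          using not_less_Least that unfolding k_def by blast
        then have row: "(g x i, g y i) \<in> E0" "(g y i, g x i) \<in> E0" if "i < k" for i
          using g(2)[of i x y] that by (auto simp: E0_iff_finite eq_commute)
        \<comment> \<open>The definition of \<open>S k\<close> overwrites the first \<open>k\<close>
          rows of the second point, so the rows taken from \<open>v\<close> disappear.\<close>
        have mix_mix: "mix k a (mix k b c) = mix k a c" for a b c
          by (auto simp: mix_def)
        \<comment> \<open>Replacing the first \<open>k\<close> rows of \<open>g y\<close> by those
          of \<open>g x\<close> keeps every row in its \<open>E0\<close>-class, so the value of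
          \<open>f\<close> stays equivalent to \<open>f (g y)\<close>, and by \<open>xy\<close> to
          \<open>f (g x)\<close>. By symmetry both pairs lie in \<open>S k\<close>, which refutes
          either case of the disjunction.\<close>
        have "(f (g y), f (mix k (g x) (g y))) \<in> E" "(f (g x), f (mix k (g y) (g x))) \<in> E"
          by (rule hom; simp add: mix_def row E0_refl)+
        from trans[OF xy this(1)] trans[OF sym[OF xy] this(2)]
        have "(g x, mix k v (g y)) \<in> S k" "(g y, mix k v (g x)) \<in> S k"
          by (simp_all add: S_def mix_mix)
        then show False
          using g(3)[where x = x and y = y and k = k, OF k] U(4)[of k] by blast
      qed
      moreover have "(f (g x), f (g y)) \<in> E" if "(x, y) \<in> E0_power UNIV" for x y
        using that hom g(2) by (simp add: E0_power_UNIV_iff)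
      moreover have "Borel_map euclidean Y (\<lambda>x. f (g x))"
        by (rule Borel_map_compose_continuous[OF _ f]) (simp add: g(1))
      ultimately have "Borel_reducible (Cantor_power (UNIV :: nat set)) (E0_power UNIV) Y E"
        unfolding Borel_reducible_def Borel_reduction_def Cantor_power_UNIV_eq_euclidean
        by (intro exI[of _ "\<lambda>x. f (g x)"]) auto
      then show False using not_red by contradiction
    qed
  qed
  then obtain k where "comeager_in euclidean (S k)" by blast
  then obtain y where y: "comeager_in euclidean {x. (x, y) \<in> S k}"
    using comeager_in_section[OF completely_metrizable_seqs] by blast
  \<comment> \<open>The tail \<open>y\<close> is common to all arguments, so points equivalent in
    the first \<open>k\<close> rows become equivalent in every row, and \<open>hom\<close>
    applies.\<close>
  define e where "e z = (\<lambda>i. if i < k then z i else y i)" for z :: seqs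
  have e_proj: "e (proj k x) = mix k x y" for x
    by (auto simp: e_def proj_def mix_def)
  let ?T = "Cantor_power {..<k}"
  have "continuous_map ?T (Cantor_power UNIV) e"
    unfolding Cantor_power_def continuous_map_componentwise_UNIV
  proof
    fix i
    show "continuous_map (product_topology (\<lambda>_. Cantor_space) {..<k}) Cantor_space (\<lambda>z. e z i)"
      by (cases "i < k")
        (auto simp: e_def Cantor_space_eq_euclidean intro: continuous_map_product_projection)
  qed
  then have "Borel_map ?T Y (\<lambda>z. f (e z))"
    using f by (simp add: Cantor_power_UNIV_eq_euclidean Borel_map_compose_continuous)
  moreover have "(f (e z1), f (e z2)) \<in> E" if "(z1, z2) \<in> E0_power {..<k}" for z1 z2
    using that by (intro hom) (auto simp: e_def E0_power_def E0_refl)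
  \<comment> \<open>The witness for the comeager domain \<open>D\<close> is the entire
    space.\<close>
  ultimately have "Borel_homomorphism (subtopology ?T (topspace ?T)) (E0_power {..<k}) Y E (\<lambda>z. f (e z))"
    by (simp add: Borel_homomorphism_def)
  moreover have "comeager_in ?T (topspace ?T)"
    by (simp add: comeager_in_def meager_in_empty)
  moreover have "comeager_in (Cantor_power UNIV)
      {x \<in> topspace (Cantor_power UNIV). proj k x \<in> topspace ?T \<and> (f (e (proj k x)), f x) \<in> E}"
  proof -
    have "proj k x \<in> topspace ?T" for x
      by (simp add: Cantor_power_def Cantor_space_eq_euclidean proj_def)
    then have "{x \<in> topspace (Cantor_power UNIV). proj k x \<in> topspace ?T \<and> (f (e (proj k x)), f x) \<in> E}
        = {x. (x, y) \<in> S k}"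
      using sym by (auto simp: Cantor_power_UNIV_eq_euclidean e_proj S_def)
    then show ?thesis
      using y by (simp add: Cantor_power_UNIV_eq_euclidean)
  qed
  ultimately show "\<exists>k :: nat. \<exists>D h.
         comeager_in (Cantor_power {..<k}) D \<and>
         Borel_homomorphism (subtopology (Cantor_power {..<k}) D) (E0_power {..<k}) Y E h \<and>
         comeager_in (Cantor_power (UNIV :: nat set))
           {x \<in> topspace (Cantor_power UNIV). proj k x \<in> D \<and> (h (proj k x), f x) \<in> E}"
    by blast
qed

end
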